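(* Let $X$ be a Banach space and let $(e_i)$ be a semi-normalized Schauder basis for $X$ with biorthogonal functionals $(e_i^* )\subset X^*$, and suppose that $(e_i)$ is bidemocratic. Suppose that there exists a constant $K>0$ such that for every $n\in\mathbb N$, every $\alpha\in\operatorname{span}((e_i))$ and every $\alpha^*\in\operatorname{span}((e_i^* ))$, $$\|\alpha\|^n\le K^n\|\alpha^n\|\quad\text{and}\quad\|\alpha^*\|_*^n\le K^n\|\alpha^{*n}\|_*.$$ Then $(e_i)$ is equivalent to the unit vector basis of $c_0$ or of $\ell_p$ for some $1\le p<\infty$.
   Context: A sequence $(e_i)$ is semi-normalized if $0<\inf_i\|e_i\|\le\sup_i\|e_i\|<\infty$. $\operatorname{span}$ denotes the set of finite linear combinations. $\|\cdot\|_*$ is the norm of $X^*$. For any semi-normalized basic sequence $(f_i)$, a multiplication $\otimes$ on $\operatorname{span}((f_i))$ is defined as follows: for $\alpha=\sum_{i=1}^n a_if_i$ and $\beta=\sum_{j=1}^m b_jf_j$ with $b_m\ne0$, $$\alpha\otimes\beta=\sum_{i=1}^n a_i\Big(\sum_{j=1}^m b_j f_{(i-1)m+j}\Big),$$ and $\alpha\otimes 0=0$. This multiplication is associative. $\alpha^n$ denotes the $n$-fold product $\alpha\otimes\cdots\otimes\alpha$ with respect to the multiplication of $(e_i)$, and $\alpha^{*n}$ denotes the $n$-fold product $\alpha^*\otimes\cdots\otimes\alpha^*$ with respect to the multiplication of $(e_i^* )$. The fundamental function of a semi-normalized basic sequence $(f_i)$ is $n\mapsto\sup\{\|\sum_{i\in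 A}f_i\|: A\subset\mathbb N,\ |A|\le n\}$. Let $\Phi$ be the fundamental function of $(e_i)$ and $\Phi^*$ that of $(e_i^* )$. The basis $(e_i)$ is bidemocratic if $\Phi^*(n)\asymp n/\Phi(n)$, where $a_n\asymp b_n$ means that there is $C>0$ with $a_n/C\le b_n\le Ca_n$ for all $n\in\mathbb N$. Two basic sequences $(x_i)$, $(y_i)$ are equivalent if there is $C>0$ with $\frac1C\|\sum a_ix_i\|\le\|\sum a_iy_i\|\le C\|\sum a_ix_i\|$ for all finitely supported scalar sequences $(a_i)$. *)

theory Defs
  imports "HOL-Analysis.Analysis" "HOL-Library.Function_Algebras"
begin

text \<open>
  Banach spaces are taken over a scalar type of class \<open>real_normed_field\<close>. Up to isometric
  isomorphism the only such fields are the reals and the complex numbers, so both cases are covered.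
  Scalar multiplication is an explicit parameter, as there is no class of complex normed spaces;
  the last axiom says that it extends the real one belonging to the type.
\<close>

locale normed_vector_space = vector_space smul
  for smul :: "'k::real_normed_field \<Rightarrow> 'a::real_normed_vector \<Rightarrow> 'a" +
  assumes norm_scale: "norm (smul c x) = norm c * norm x"
    and scale_of_real: "smul (of_real r) x = r *\<^sub>R x"

lemma normed_vector_space_scaleR:
  "normed_vector_space (scaleR :: real \<Rightarrow> 'a::real_normed_vector \<Rightarrow> 'a)"
  by unfold_locales (simp_all add: scaleR_right_distrib scaleR_left_distrib)

lemma normed_vector_space_mult:
  "normed_vector_space ((*) :: 'k::real_normed_field \<Rightarrow> 'k \<Rightarrow> 'k)"
  by unfold_locales (simp_all add: algebra_simps norm_mult scaleR_conv_of_real)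

text \<open>
  The dual space consists of the bounded real-linear maps into the scalars that are moreover linear
  over the scalars; its norm is the operator norm, that is, the norm of type \<open>'a \<Rightarrow>\<^sub>L 'k\<close>.
\<close>

definition dual_space ::
    "('k::real_normed_field \<Rightarrow> 'a::real_normed_vector \<Rightarrow> 'a) \<Rightarrow> ('a \<Rightarrow>\<^sub>L 'k) set" where
  "dual_space smul = {f. \<forall>c x. blinfun_apply f (smul c x) = c * blinfun_apply f x}"

definition dual_scale ::
    "'k::real_normed_field \<Rightarrow> ('a::real_normed_vector \<Rightarrow>\<^sub>L 'k) \<Rightarrow> ('a \<Rightarrow>\<^sub>L 'k)" where
  "dual_scale c f = blinfun_mult_right c o\<^sub>L f"

lemma dual_scale_apply [simp]:
  "blinfun_apply (dual_scale c f) x = c * blinfun_apply f x"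
  by (simp add: dual_scale_def)

lemma norm_dual_scale: "norm (dual_scale c f) = norm c * norm f"
proof (rule antisym)
  have upper: "norm (dual_scale d g) \<le> norm d * norm g"
    for d :: 'b and g :: "'a \<Rightarrow>\<^sub>L 'b"
  proof (rule norm_blinfun_bound)
    fix x
    show "norm (blinfun_apply (dual_scale d g) x) \<le> norm d * norm g * norm x"
      using mult_left_mono [OF norm_blinfun [of g x] norm_ge_zero [of d]]
      by (simp add: norm_mult mult.assoc)
  qed simp
  show "norm (dual_scale c f) \<le> norm c * norm f"
    by (rule upper)
  show "norm c * norm f \<le> norm (dual_scale c f)"
  proof (cases "c = 0")
    case False
    have "dual_scale (inverse c) (dual_scale c f) = f"
      using False by (intro blinfun_eqI) simp
    with upper [of "inverse c" "dual_scale c f"] False show ?thesis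
      by (simp add: norm_divide field_simps)
  qed simp
qed

lemma normed_vector_space_dual_scale:
  "normed_vector_space (dual_scale :: 'k::real_normed_field \<Rightarrow> ('a::real_normed_vector \<Rightarrow>\<^sub>L 'k) \<Rightarrow> _)"
  by unfold_locales
    (auto intro!: blinfun_eqI simp: blinfun.bilinear_simps algebra_simps norm_dual_scale
      scaleR_conv_of_real)

text \<open>
  Sequences are indexed from \<open>0\<close>: the \<open>i\<close>-th term of the mathematical sequence is \<open>f (i - 1)\<close>.
\<close>

definition semi_normalized :: "(nat \<Rightarrow> 'a::real_normed_vector) \<Rightarrow> bool" where
  "semi_normalized f \<longleftrightarrow> 0 < (INF i. norm (f i)) \<and> bdd_above (range (\<lambda>i. norm (f i)))"

definition schauder_basis ::
    "('k::real_normed_field \<Rightarrow> 'a::real_normed_vector \<Rightarrow> 'a) \<Rightarrow> (nat \<Rightarrow> 'a) \<Rightarrow> bool" where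
  "schauder_basis smul e \<longleftrightarrow> (\<forall>x. \<exists>!a. (\<lambda>i. smul (a i) (e i)) sums x)"

definition biorthogonal_functionals ::
    "('k::real_normed_field \<Rightarrow> 'a::real_normed_vector \<Rightarrow> 'a) \<Rightarrow> (nat \<Rightarrow> 'a) \<Rightarrow>
      (nat \<Rightarrow> 'a \<Rightarrow>\<^sub>L 'k) \<Rightarrow> bool" where
  "biorthogonal_functionals smul e e' \<longleftrightarrow>
    (\<forall>i. e' i \<in> dual_space smul) \<and>
    (\<forall>i j. blinfun_apply (e' i) (e j) = (if i = j then 1 else 0))"

text \<open>
  Coefficients of a vector in the span of a linearly independent sequence (injective, in particular).
\<close>

definition seq_coeff ::
    "('k::field \<Rightarrow> 'a::ab_group_add \<Rightarrow> 'a) \<Rightarrow> (nat \<Rightarrow> 'a) \<Rightarrow> 'a \<Rightarrow> nat \<Rightarrow> 'k" where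
  "seq_coeff smul f v i = module.representation smul (range f) v (f i)"

text \<open>The number \<open>m\<close> with last nonzero coefficient \<open>b\<^sub>m\<close> (counted from \<open>1\<close>), and \<open>0\<close> for the zero vector.\<close>

definition seq_length ::
    "('k::field \<Rightarrow> 'a::ab_group_add \<Rightarrow> 'a) \<Rightarrow> (nat \<Rightarrow> 'a) \<Rightarrow> 'a \<Rightarrow> nat" where
  "seq_length smul f v = (LEAST m. \<forall>i\<ge>m. seq_coeff smul f v i = 0)"

text \<open>
  With indices starting from \<open>0\<close>, \<open>f\<^bsub>(i-1)m+j\<^esub>\<close> becomes \<open>f (i * m + j)\<close>.
  For \<open>v = 0\<close> the inner sums are empty, so the product is \<open>0\<close>.
\<close>

definition seq_mult ::
    "('k::field \<Rightarrow> 'a::ab_group_add \<Rightarrow> 'a) \<Rightarrow> (nat \<Rightarrow> 'a) \<Rightarrow> 'a \<Rightarrow> 'a \<Rightarrow> 'a" where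
  "seq_mult smul f u v =
    (\<Sum>i<seq_length smul f u. smul (seq_coeff smul f u i)
      (\<Sum>j<seq_length smul f v. smul (seq_coeff smul f v j)
        (f (i * seq_length smul f v + j))))"

text \<open>The \<open>n\<close>-fold product, meaningful for \<open>n \<ge> 1\<close>.\<close>

definition seq_power ::
    "('k::field \<Rightarrow> 'a::ab_group_add \<Rightarrow> 'a) \<Rightarrow> (nat \<Rightarrow> 'a) \<Rightarrow> 'a \<Rightarrow> nat \<Rightarrow> 'a" where
  "seq_power smul f v n = ((\<lambda>w. seq_mult smul f w v) ^^ (n - 1)) v"

text \<open>The supremum is over a bounded set of reals whenever \<open>f\<close> is norm-bounded.\<close>

definition fundamental_function :: "(nat \<Rightarrow> 'a::real_normed_vector) \<Rightarrow> nat \<Rightarrow> real" where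
  "fundamental_function f n = (SUP A\<in>{A. finite A \<and> card A \<le> n}. norm (\<Sum>i\<in>A. f i))"

definition asymp_equal :: "(nat \<Rightarrow> real) \<Rightarrow> (nat \<Rightarrow> real) \<Rightarrow> bool" where
  "asymp_equal a b \<longleftrightarrow> (\<exists>C>0. \<forall>n\<ge>1. a n / C \<le> b n \<and> b n \<le> C * a n)"

definition bidemocratic ::
    "(nat \<Rightarrow> 'a::real_normed_vector) \<Rightarrow> (nat \<Rightarrow> 'b::real_normed_vector) \<Rightarrow> bool" where
  "bidemocratic e e' \<longleftrightarrow>
    asymp_equal (fundamental_function e') (\<lambda>n. real n / fundamental_function e n)"

text \<open>
  Equivalence of sequences in two normed spaces. The norms are explicit so that the second space may
  be a space of scalar sequences.
\<close>

definition equivalent_seqs ::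
    "('k::real_normed_field \<Rightarrow> 'a::ab_group_add \<Rightarrow> 'a) \<Rightarrow> ('a \<Rightarrow> real) \<Rightarrow> (nat \<Rightarrow> 'a) \<Rightarrow>
      ('k \<Rightarrow> 'b::ab_group_add \<Rightarrow> 'b) \<Rightarrow> ('b \<Rightarrow> real) \<Rightarrow> (nat \<Rightarrow> 'b) \<Rightarrow> bool" where
  "equivalent_seqs smul\<^sub>X norm\<^sub>X x smul\<^sub>Y norm\<^sub>Y y \<longleftrightarrow>
    (\<exists>C>0. \<forall>a. finite {i. a i \<noteq> 0} \<longrightarrow>
      1 / C * norm\<^sub>X (\<Sum>i | a i \<noteq> 0. smul\<^sub>X (a i) (x i))
        \<le> norm\<^sub>Y (\<Sum>i | a i \<noteq> 0. smul\<^sub>Y (a i) (y i)) \<and>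
      norm\<^sub>Y (\<Sum>i | a i \<noteq> 0. smul\<^sub>Y (a i) (y i))
        \<le> C * norm\<^sub>X (\<Sum>i | a i \<noteq> 0. smul\<^sub>X (a i) (x i)))"

text \<open>
  The norms of \<open>c\<^sub>0\<close> and \<open>\<ell>\<^sub>p\<close>, given on all scalar sequences and meaningful on
  the members of these spaces, which include all finitely supported sequences.
\<close>

definition seq_scale :: "'k::real_normed_field \<Rightarrow> (nat \<Rightarrow> 'k) \<Rightarrow> (nat \<Rightarrow> 'k)" where
  "seq_scale c x = (\<lambda>i. c * x i)"

definition c0_norm :: "(nat \<Rightarrow> 'k::real_normed_field) \<Rightarrow> real" where
  "c0_norm x = (SUP i. norm (x i))"

definition lp_norm :: "real \<Rightarrow> (nat \<Rightarrow> 'k::real_normed_field) \<Rightarrow> real" where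
  "lp_norm p x = (\<Sum>i. norm (x i) powr p) powr (1 / p)"

definition unit_vector :: "nat \<Rightarrow> nat \<Rightarrow> 'k::real_normed_field" where
  "unit_vector i = (\<lambda>j. if j = i then 1 else 0)"

end

theory Submission
  imports Defs
begin

text \<open>
  Bidemocracy makes \<open>\<Phi> m\<close> comparable to the norm of the sum of the first \<open>m\<close> basis vectors, whose
  \<open>n\<close>-th power is the sum of the first \<open>m ^ n\<close>. The two power estimates thus bound
  \<open>\<Phi> (m ^ n) / \<Phi> m ^ n\<close> from both sides by \<open>n\<close>-th powers of constants, which forces \<open>\<Phi> m \<asymp> m powr \<theta>\<close>
  with \<open>0 \<le> \<theta> \<le> 1\<close>, and then the dual fundamental function grows like \<open>m powr (1 - \<theta>)\<close>. Grouping
  equal coefficients in high powers of a vector turns this into the upper \<open>\<ell>\<^sub>p\<close>-estimate, \<open>p = 1 / \<theta>\<close>,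
  without loss in the exponent. The lower estimate is dual to the upper estimate for the
  biorthogonal functionals.
\<close>

section \<open>Uniform boundedness, removal of subexponential factors, and power growth\<close>

text \<open>Banach-Steinhaus by Baire: one of the closed sets \<open>T n\<close> contains a ball
  around some \<open>x0\<close>, and subtracting the value at \<open>x0\<close> turns the bound on
  that ball into one near the origin, hence into an operator norm bound.\<close>

lemma uniform_boundedness:
  fixes f :: "nat \<Rightarrow> 'a::banach \<Rightarrow>\<^sub>L 'b::real_normed_vector"
  assumes bdd: "\<And>x. bdd_above (range (\<lambda>i. norm (blinfun_apply (f i) x)))"
  shows "bdd_above (range (\<lambda>i. norm (f i)))"
proof -
  define T where "T n = {x. \<forall>i. norm (blinfun_apply (f i) x) \<le> real n}" for n :: nat
  have closed: "closed (T n)" for n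
    unfolding T_def by (intro closed_Collect_all closed_Collect_le continuous_intros)
  have "(\<Union>n. T n) = UNIV"
  proof -
    have "\<exists>n. x \<in> T n" for x
    proof -
      obtain B where "\<And>i. norm (blinfun_apply (f i) x) \<le> B"
        using bdd [of x] by (auto simp: bdd_above_def)
      moreover obtain n :: nat where "B \<le> real n"
        using real_arch_simple by blast
      ultimately show ?thesis
        unfolding T_def by (blast intro: order_trans)
    qed
    then show ?thesis by auto
  qed
  moreover have "completely_metrizable_space (euclidean :: 'a topology)"
    by (rule completely_metrizable_space_euclidean)
  ultimately obtain n where "interior (T n) \<noteq> {}"
    using Baire_category_alt [of "euclidean :: 'a topology" "range T"] closed by force
  then obtain x0 r where r: "r > 0" "cball x0 r \<subseteq> T n"
    by (meson ex_in_conv mem_interior_cball)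
  have "norm (f i) \<le> 2 * real n / r" for i
  proof (rule norm_blinfun_bound)
    fix x
    show "norm (blinfun_apply (f i) x) \<le> 2 * real n / r * norm x"
    proof (cases "x = 0")
      case False
      let ?y = "x0 + (r / norm x) *\<^sub>R x"
      have "?y \<in> T n" "x0 \<in> T n"
        using r False by (auto simp: dist_norm intro!: subsetD [OF r(2)])
      then have "norm (blinfun_apply (f i) ?y) \<le> n" "norm (blinfun_apply (f i) x0) \<le> n"
        by (auto simp: T_def)
      then have "norm (blinfun_apply (f i) ?y - blinfun_apply (f i) x0) \<le> 2 * real n"
        using norm_triangle_ineq4 [of "blinfun_apply (f i) ?y" "blinfun_apply (f i) x0"] by linarith
      then have "(r / norm x) * norm (blinfun_apply (f i) x) \<le> 2 * real n"
        using r by (simp add: blinfun.bilinear_simps)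
      then show ?thesis
        using r False by (simp add: field_simps)
    qed simp
  qed (use r in simp)
  then show ?thesis by (auto simp: bdd_above_def)
qed

text \<open>Dividing by \<open>n\<close> kills the fixed error \<open>d\<close>. On logarithms this
  is the passage to n-th roots.\<close>

lemma le_of_linear_bound:
  fixes x y d :: real
  assumes "\<And>n. n \<ge> 1 \<Longrightarrow> real n * x \<le> real n * y + d"
  shows "x \<le> y"
proof (rule ccontr)
  assume "\<not> x \<le> y"
  obtain n' where "d / (x - y) < real n'"
    using reals_Archimedean2 by blast
  then obtain n where n: "d / (x - y) < real n" "n \<ge> 1"
    by (intro that [of "Suc n'"]) auto
  show False
    using n(1) assms [OF n(2)] \<open>\<not> x \<le> y\<close> by (simp add: field_simps)
qed

text \<open>The n-th root of a polynomial in n tends to 1: otherwise the powers of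
  \<open>z = x / y > 1\<close> would be dominated by a polynomial.\<close>

lemma le_of_power_le_poly_mult_power:
  fixes x y C :: real
  assumes le: "\<And>n. n \<ge> 1 \<Longrightarrow> x ^ n \<le> C * real (n + 1) ^ m * y ^ n"
    and "y \<ge> 0"
  shows "x \<le> y"
proof (cases "y = 0")
  case True
  then show ?thesis using le [of 1] by simp
next
  case False
  show ?thesis
  proof (rule ccontr)
    assume "\<not> x \<le> y"
    define z where "z = x / y"
    have z: "z > 1" using False \<open>y \<ge> 0\<close> \<open>\<not> x \<le> y\<close> by (simp add: z_def)
    have "filterlim (\<lambda>n. real n * ln z) at_top sequentially"
      using z by (intro filterlim_at_top_mult_tendsto_pos [OF tendsto_const] ln_gt_zero filterlim_real_sequentially)
    \<comment> \<open>Evaluating \<open>t ^ m / exp t\<close> at \<open>t = (n + 1) * ln z\<close>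
      produces the polynomial of the hypothesis; the surplus factor \<open>z\<close> from
      \<open>z ^ Suc n\<close> goes into the constant.\<close>
    then have "filterlim (\<lambda>n. real (Suc n) * ln z) at_top sequentially"
      by (rule filterlim_compose [OF _ filterlim_Suc])
    from filterlim_compose [OF tendsto_power_div_exp_0 this]
    have "(\<lambda>n. (C * z / ln z ^ m) * ((real (Suc n) * ln z) ^ m / exp (real (Suc n) * ln z))) \<longlonglongrightarrow> 0"
      by (rule tendsto_mult_right_zero)
    moreover have "(C * z / ln z ^ m) * ((real (Suc n) * ln z) ^ m / exp (real (Suc n) * ln z)) =
        C * real (n + 1) ^ m / z ^ n" for n
    proof -
      have "exp (real (Suc n) * ln z) = z ^ Suc n"
        using z by (subst exp_of_nat_mult) simp
      then show ?thesis using z by (simp add: power_mult_distrib)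
    qed
    ultimately have "(\<lambda>n. C * real (n + 1) ^ m / z ^ n) \<longlonglongrightarrow> 0"
      by simp
    then have "eventually (\<lambda>n. C * real (n + 1) ^ m / z ^ n < 1) sequentially"
      by (rule order_tendstoD) simp
    then have "eventually (\<lambda>n. C * real (n + 1) ^ m / z ^ n < 1 \<and> n \<ge> 1) sequentially"
      by (intro eventually_conj eventually_ge_at_top)
    then obtain n where n: "C * real (n + 1) ^ m / z ^ n < 1" "n \<ge> 1"
      using eventually_happens'[OF sequentially_bot] by blast
    have "C * real (n + 1) ^ m < z ^ n"
      using n z by (simp add: field_simps)
    then have "C * real (n + 1) ^ m * y ^ n < x ^ n"
      using False \<open>y \<ge> 0\<close> by (simp add: z_def power_divide field_simps)
    then show False using le [OF n(2)] by simp
  qed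
qed

text \<open>On the logarithm \<open>g\<close>, the hypotheses say that \<open>g (m ^ n)\<close> is
  \<open>n * g m\<close> up to \<open>n * c\<close>. Monotonicity lets powers of different bases be
  compared, so the quotients \<open>g m / ln m\<close> all agree with one number up to
  \<open>c / ln m\<close>.\<close>

lemma almost_multiplicative_imp_powr_growth:
  fixes \<Phi> :: "nat \<Rightarrow> real"
  assumes pos: "\<And>m. m \<ge> 1 \<Longrightarrow> \<Phi> m > 0"
    and mono: "\<And>m n. 1 \<le> m \<Longrightarrow> m \<le> n \<Longrightarrow> \<Phi> m \<le> \<Phi> n"
    and L: "L \<ge> 1"
    and lower: "\<And>m n. m \<ge> 1 \<Longrightarrow> n \<ge> 1 \<Longrightarrow> \<Phi> m ^ n \<le> L ^ n * \<Phi> (m ^ n)"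
    and upper: "\<And>m n. m \<ge> 1 \<Longrightarrow> n \<ge> 1 \<Longrightarrow> \<Phi> (m ^ n) \<le> L ^ n * \<Phi> m ^ n"
  shows "\<exists>\<theta> C. C > 0 \<and> (\<forall>m\<ge>1. real m powr \<theta> \<le> C * \<Phi> m \<and> \<Phi> m \<le> C * real m powr \<theta>)"
proof -
  define g where "g m = ln (\<Phi> m)" for m
  define c where "c = ln L"
  have c: "c \<ge> 0" using L by (simp add: c_def)
  have g_lower: "real n * g m \<le> real n * c + g (m ^ n)" if "m \<ge> 1" "n \<ge> 1" for m n
  proof -
    have "ln (\<Phi> m ^ n) \<le> ln (L ^ n * \<Phi> (m ^ n))"
      using lower [OF that] pos [of m] pos [of "m ^ n"] L that by (subst ln_le_cancel_iff) auto
    then show ?thesis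
      using pos [of m] pos [of "m ^ n"] L that by (simp add: g_def c_def ln_mult ln_realpow)
  qed
  have g_upper: "g (m ^ n) \<le> real n * c + real n * g m" if "m \<ge> 1" "n \<ge> 1" for m n
  proof -
    have "ln (\<Phi> (m ^ n)) \<le> ln (L ^ n * \<Phi> m ^ n)"
      using upper [OF that] pos [of m] pos [of "m ^ n"] L that by (subst ln_le_cancel_iff) auto
    then show ?thesis
      using pos [of m] pos [of "m ^ n"] L that by (simp add: g_def c_def ln_mult ln_realpow)
  qed
  have g_mono: "g m \<le> g n" if "1 \<le> m" "m \<le> n" for m n
    using mono [OF that] pos [of m] pos [of n] that by (simp add: g_def)
  text \<open>Compare \<open>M ^ k \<le> m ^ n\<close> for \<open>k = \<lfloor>n log\<^sub>M m\<rfloor>\<close> and let \<open>n\<close> tend to infinity.\<close>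
  have compare: "(g M - c) / ln (real M) \<le> (g m + c) / ln (real m)" if "m \<ge> 2" "M \<ge> 2" for m M
  proof -
    define x where "x = ln (real m) / ln (real M)"
    have lnm: "ln (real m) > 0" "ln (real M) > 0" using that by auto
    have x: "x > 0" using lnm by (simp add: x_def)
    have "real n * (x * (g M - c)) \<le> real n * (g m + c) + (\<bar>g M - c\<bar> + \<bar>g 1\<bar> + \<bar>g M\<bar>)"
      if n: "n \<ge> 1" for n
    proof -
      define k where "k = nat \<lfloor>real n * x\<rfloor>"
      have k: "real k \<le> real n * x" "real n * x < real k + 1"
        using x by (simp_all add: k_def)
      have "real k * ln (real M) \<le> real n * ln (real m)"
        using k(1) lnm by (simp add: x_def field_simps)
      then have "ln (real (M ^ k)) \<le> ln (real (m ^ n))"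
        using \<open>m \<ge> 2\<close> \<open>M \<ge> 2\<close> by (simp add: ln_realpow)
      then have "real (M ^ k) \<le> real (m ^ n)"
        using \<open>m \<ge> 2\<close> \<open>M \<ge> 2\<close> by (subst (asm) ln_le_cancel_iff) auto
      then have "M ^ k \<le> m ^ n" by (simp only: of_nat_le_iff)
      then have gk: "g (M ^ k) \<le> g (m ^ n)"
        using \<open>M \<ge> 2\<close> by (intro g_mono) auto
      \<comment> \<open>For \<open>k = 0\<close>, where \<open>g_lower\<close> does not apply, the
        left side is 0; the term in \<open>g 1\<close> keeps the right side nonnegative, as
        \<open>M ^ 0 = 1\<close>.\<close>
      have "real k * (g M - c) \<le> g (M ^ k) + \<bar>g 1\<bar>"
      proof (cases "k = 0")
        case False
        then show ?thesis using g_lower [of M k] \<open>M \<ge> 2\<close> by (simp add: algebra_simps)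
      qed simp
      also have "\<dots> \<le> real n * (g m + c) + \<bar>g 1\<bar>"
        using gk g_upper [of m n] \<open>m \<ge> 2\<close> n by (simp add: algebra_simps)
      finally have 1: "real k * (g M - c) \<le> real n * (g m + c) + \<bar>g 1\<bar>" .
      \<comment> \<open>Rounding down to \<open>k\<close> loses less than one multiple of
        \<open>g M - c\<close>, whose sign is unknown.\<close>
      have "(real n * x - real k) * (g M - c) \<le> (real n * x - real k) * \<bar>g M - c\<bar>"
        using k by (intro mult_left_mono) auto
      also have "\<dots> \<le> 1 * \<bar>g M - c\<bar>"
        using k by (intro mult_right_mono) auto
      finally have "(real n * x - real k) * (g M - c) \<le> \<bar>g M - c\<bar>" by simp
      with 1 show ?thesis by (simp add: algebra_simps)
    qed
    then have "x * (g M - c) \<le> g m + c"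
      by (rule le_of_linear_bound)
    then show ?thesis using lnm by (simp add: x_def field_simps)
  qed
  \<comment> \<open>By \<open>compare\<close> every lower quotient lies below every upper quotient,
    so the supremum of the lower ones separates the two families.\<close>
  define S where "S = (\<lambda>M. (g M - c) / ln (real M)) ` {2..}"
  define \<theta> where "\<theta> = Sup S"
  have bdd: "bdd_above S"
    using compare [of 2] by (auto simp: S_def bdd_above_def)
  have up: "g m \<le> \<theta> * ln (real m) + c" if "m \<ge> 2" for m
  proof -
    have "(g m - c) / ln (real m) \<le> \<theta>"
      unfolding \<theta>_def using bdd that by (intro cSup_upper) (auto simp: S_def)
    then show ?thesis using that by (simp add: field_simps)
  qed
  have lo: "\<theta> * ln (real m) \<le> g m + c" if "m \<ge> 2" for m
  proof -
    have "\<theta> \<le> (g m + c) / ln (real m)"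
      unfolding \<theta>_def using compare [of m] that by (intro cSup_least) (auto simp: S_def)
    then show ?thesis using that by (simp add: field_simps)
  qed
  \<comment> \<open>At \<open>m = 1\<close> the logarithm vanishes and no quotient exists, so
    \<open>g 1\<close> enters the constant.\<close>
  define c' where "c' = c + \<bar>g 1\<bar>"
  have "real m powr \<theta> \<le> exp c' * \<Phi> m \<and> \<Phi> m \<le> exp c' * real m powr \<theta>" if m: "m \<ge> 1" for m
  proof -
    have "\<theta> * ln (real m) \<le> c' + g m \<and> g m \<le> c' + \<theta> * ln (real m)"
    proof (cases "m = 1")
      case True
      then show ?thesis using c by (auto simp: c'_def)
    next
      case False
      then show ?thesis using up [of m] lo [of m] m by (auto simp: c'_def)
    qed
    then have "exp (\<theta> * ln (real m)) \<le> exp (c' + g m)" "exp (g m) \<le> exp (c' + \<theta> * ln (real m))"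
      by simp_all
    then show ?thesis
      using m pos [of m] by (simp add: powr_def exp_add g_def)
  qed
  then show ?thesis by (intro exI [of _ \<theta>] exI [of _ "exp c'"]) simp
qed

section \<open>Coefficients of powers as products over digits\<close>

text \<open>The coefficient at position \<open>k\<close> of the n-th power of a vector with
  coefficients \<open>a\<close> and length \<open>m\<close>: the digits of \<open>k\<close> in base
  \<open>m\<close> select the factors, the last digit belonging to the rightmost factor.\<close>

primrec digit_prod :: "(nat \<Rightarrow> 'k::comm_monoid_mult) \<Rightarrow> nat \<Rightarrow> nat \<Rightarrow> nat \<Rightarrow> 'k" where
  "digit_prod a m 0 k = 1"
| "digit_prod a m (Suc n) k = digit_prod a m n (k div m) * a (k mod m)"

lemma sum_lessThan_mult:
  "(\<Sum>k<L * m. F k) = (\<Sum>i<L. \<Sum>j<m. F (i * m + j))" for L m :: nat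
proof -
  have "(\<Sum>k<L * m. F k) = (\<Sum>i<L. sum F {i * m..<i * m + m})"
    by (rule sum.nat_group [symmetric])
  also have "\<dots> = (\<Sum>i<L. \<Sum>j<m. F (i * m + j))"
    using sum.atLeastLessThan_shift_0 [of F "i * m" "i * m + m" for i]
    by (simp add: atLeast0LessThan)
  finally show ?thesis .
qed

text \<open>Each word of \<open>n\<close> digits occurs exactly once below \<open>m ^ n\<close>, so
  the sum factors. In other words, the l_p norm is multiplicative.\<close>

lemma sum_norm_digit_prod_powr:
  fixes a :: "nat \<Rightarrow> 'k::real_normed_field"
  shows "(\<Sum>k<m ^ n. norm (digit_prod a m n k) powr p) = (\<Sum>j<m. norm (a j) powr p) ^ n"
proof (induction n)
  case (Suc n)
  have "(\<Sum>k<m ^ Suc n. norm (digit_prod a m (Suc n) k) powr p) =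
      (\<Sum>i<m ^ n. \<Sum>j<m. norm (digit_prod a m n i) powr p * norm (a j) powr p)"
    unfolding power_Suc2 sum_lessThan_mult
    by (intro sum.cong refl) (auto simp: norm_mult powr_mult)
  also have "\<dots> = (\<Sum>j<m. norm (a j) powr p) ^ Suc n"
    by (simp add: sum_product [symmetric] Suc)
  finally show ?case .
qed simp

lemma norm_digit_prod_le:
  fixes a :: "nat \<Rightarrow> 'k::real_normed_field"
  assumes "\<And>j. j < m \<Longrightarrow> norm (a j) \<le> N" "0 < m"
  shows "norm (digit_prod a m n k) \<le> N ^ n"
proof (induction n arbitrary: k)
  case (Suc n)
  have "norm (digit_prod a m n (k div m)) * norm (a (k mod m)) \<le> N ^ n * N"
    using assms Suc order_trans [OF norm_ge_zero assms(1) [of 0]] by (intro mult_mono) auto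
  then show ?case by (simp add: norm_mult mult.commute)
qed simp

text \<open>By commutativity only the number \<open>\<kappa> j\<close> of digits equal to
  \<open>j\<close> matters. Extensional functions make the exponent vectors a finite,
  countable-by-formula set.\<close>

lemma digit_prod_eq_monomial:
  assumes "0 < m"
  shows "\<exists>\<kappa>\<in>{..<m} \<rightarrow>\<^sub>E {..n}. digit_prod a m n k = (\<Prod>j<m. a j ^ \<kappa> j)"
proof (induction n arbitrary: k)
  case 0
  show ?case by (intro bexI [of _ "\<lambda>j\<in>{..<m}. 0"]) auto
next
  case (Suc n)
  obtain \<kappa> where \<kappa>: "\<kappa> \<in> {..<m} \<rightarrow>\<^sub>E {..n}" "digit_prod a m n (k div m) = (\<Prod>j<m. a j ^ \<kappa> j)"
    using Suc by blast
  let ?r = "k mod m"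
  let ?\<kappa> = "\<kappa>(?r := Suc (\<kappa> ?r))"
  have r: "?r \<in> {..<m}" using assms by simp
  have "(\<Prod>j<m. a j ^ ?\<kappa> j) = a ?r ^ Suc (\<kappa> ?r) * (\<Prod>j\<in>{..<m} - {?r}. a j ^ \<kappa> j)"
    using r by (subst prod.remove [of _ ?r]) (auto intro!: arg_cong2 [where f = "(*)"] prod.cong)
  also have "\<dots> = (\<Prod>j<m. a j ^ \<kappa> j) * a ?r"
    using r by (subst prod.remove [of _ ?r]) (auto simp: mult_ac)
  finally have "digit_prod a m (Suc n) k = (\<Prod>j<m. a j ^ ?\<kappa> j)"
    using \<kappa> by simp
  moreover have "?\<kappa> \<in> {..<m} \<rightarrow>\<^sub>E {..Suc n}"
  proof (rule PiE_I)
    show "?\<kappa> j \<in> {..Suc n}" if "j \<in> {..<m}" for j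
      using PiE_mem [OF \<kappa>(1) that] by auto
    show "?\<kappa> j = undefined" if "j \<notin> {..<m}" for j
      using PiE_arb [OF \<kappa>(1) that] that r by auto
  qed
  ultimately show ?case by blast
qed

text \<open>There are \<open>m ^ n\<close> positions, but for fixed \<open>m\<close> only
  polynomially many exponent vectors, hence values.\<close>

lemma card_range_digit_prod_le:
  assumes "0 < m"
  shows "card (digit_prod a m n ` A) \<le> (n + 1) ^ m"
proof -
  have "digit_prod a m n ` A \<subseteq> (\<lambda>\<kappa>. \<Prod>j<m. a j ^ \<kappa> j) ` ({..<m} \<rightarrow>\<^sub>E {..n})"
    using digit_prod_eq_monomial [OF assms] by fast
  then have "card (digit_prod a m n ` A) \<le> card ({..<m} \<rightarrow>\<^sub>E {..n})"
    by (intro surj_card_le finite_PiE) auto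
  also have "\<dots> = (n + 1) ^ m" by (simp add: card_PiE)
  finally show ?thesis .
qed

section \<open>Exponents and fundamental functions\<close>

text \<open>Tested along the powers of 2, where logarithms give a bound linear in n. It will confine
  the growth exponent to the unit interval.\<close>

lemma powr_bounded_imp_nonpos:
  fixes s D :: real
  assumes "\<And>m::nat. m \<ge> 1 \<Longrightarrow> real m powr s \<le> D"
  shows "s \<le> 0"
proof -
  have "s * ln 2 \<le> 0"
  proof (rule le_of_linear_bound)
    fix n :: nat
    have "D > 0" using assms [of 1] by simp
    then have "ln (real (2 ^ n) powr s) \<le> ln D"
      using assms [of "2 ^ n"] by (subst ln_le_cancel_iff) auto
    then show "real n * (s * ln 2) \<le> real n * 0 + ln D"
      by (simp add: ln_powr ln_realpow algebra_simps)
  qed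
  then show ?thesis by (simp add: mult_le_0_iff)
qed

lemma
  fixes f :: "nat \<Rightarrow> 'a::real_normed_vector"
  assumes B: "\<And>i. norm (f i) \<le> B"
  shows norm_sum_le_fundamental_function:
      "finite A \<Longrightarrow> card A \<le> n \<Longrightarrow> norm (sum f A) \<le> fundamental_function f n"
    and fundamental_function_mono:
      "m \<le> n \<Longrightarrow> fundamental_function f m \<le> fundamental_function f n"
    and fundamental_function_le: "fundamental_function f n \<le> real n * B"
proof -
  have B0: "0 \<le> B" using order_trans [OF norm_ge_zero B] .
  have le: "norm (sum f A) \<le> real n * B" if "finite A" "card A \<le> n" for A n
  proof -
    have "norm (sum f A) \<le> real (card A) * B"
      using B by (intro sum_norm_le [THEN order_trans]) (auto intro: sum_bounded_above)
    also have "\<dots> \<le> real n * B"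
      using that B0 by (intro mult_right_mono) auto
    finally show ?thesis .
  qed
  \<comment> \<open>A real \<open>SUP\<close> is an upper bound of its family only once that family
    is known to be bounded.\<close>
  have bdd: "bdd_above ((\<lambda>A. norm (sum f A)) ` {A. finite A \<and> card A \<le> n})" for n
    using le by (intro bdd_aboveI2 [of _ _ "real n * B"]) auto
  show "norm (sum f A) \<le> fundamental_function f n" if "finite A" "card A \<le> n" for A n
    unfolding fundamental_function_def by (rule cSUP_upper [OF _ bdd]) (use that in auto)
  show "fundamental_function f m \<le> fundamental_function f n" if "m \<le> n" for m n
    unfolding fundamental_function_def by (rule cSUP_subset_mono [OF _ bdd]) (use that in auto)
  show "fundamental_function f n \<le> real n * B" for n
    unfolding fundamental_function_def
    by (rule cSUP_least) (use le in \<open>auto intro!: exI [of _ "{}"]\<close>)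
qed

section \<open>The sequence norms and their duality\<close>

text \<open>Parametrising the spaces by \<open>\<theta> = 1/p\<close> puts \<open>c\<^sub>0\<close> (\<open>\<theta> = 0\<close>) on the same footing as
  \<open>\<ell>\<^sub>p\<close>; the conjugate exponent is \<open>1 - \<theta>\<close>.\<close>

definition recip_lp_norm :: "real \<Rightarrow> (nat \<Rightarrow> 'k::real_normed_field) \<Rightarrow> real" where
  "recip_lp_norm \<theta> a = (if \<theta> = 0 then c0_norm a else lp_norm (1 / \<theta>) a)"

lemma norm_le_c0_norm:
  assumes "finite {i. a i \<noteq> 0}"
  shows "norm (a i) \<le> c0_norm a"
proof -
  have "range (\<lambda>i. norm (a i)) \<subseteq> insert 0 ((\<lambda>i. norm (a i)) ` {i. a i \<noteq> 0})" by auto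
  then have "finite (range (\<lambda>i. norm (a i)))"
    using assms by (meson finite_imageI finite_insert finite_subset)
  then show ?thesis
    unfolding c0_norm_def by (intro cSUP_upper bdd_above_finite) auto
qed

lemma lp_norm_finite:
  assumes "finite S" "\<And>i. i \<notin> S \<Longrightarrow> a i = 0"
  shows "lp_norm p a = (\<Sum>i\<in>S. norm (a i) powr p) powr (1 / p)"
  unfolding lp_norm_def using assms by (subst suminf_finite [of S]) auto

lemma recip_lp_norm_nonneg:
  assumes "finite {i. a i \<noteq> 0}"
  shows "0 \<le> recip_lp_norm \<theta> a"
  using order_trans [OF norm_ge_zero norm_le_c0_norm [OF assms]]
  by (simp add: recip_lp_norm_def lp_norm_def)

text \<open>The equality case of Hoelder's inequality: \<open>b\<close> is a sequence on the support
  of \<open>a\<close> that norms it. This is what turns an upper estimate for the functionals into a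
  lower one for the vectors.\<close>

lemma holder_extremal:
  fixes a :: "nat \<Rightarrow> 'k::real_normed_field"
  assumes fin: "finite {i. a i \<noteq> 0}" and nz: "{i. a i \<noteq> 0} \<noteq> {}" and \<theta>: "0 \<le> \<theta>" "\<theta> \<le> 1"
  shows "\<exists>b. {i. b i \<noteq> 0} \<subseteq> {i. a i \<noteq> 0} \<and> 0 < recip_lp_norm (1 - \<theta>) b \<and>
    recip_lp_norm \<theta> a * recip_lp_norm (1 - \<theta>) b \<le> norm (\<Sum>i | a i \<noteq> 0. a i * b i)"
proof -
  let ?S = "{i. a i \<noteq> 0}"
  consider "\<theta> = 0" | "\<theta> = 1" | "0 < \<theta>" "\<theta> < 1" using \<theta> by linarith
  then show ?thesis
  proof cases
    case 1
    have "Max ((\<lambda>i. norm (a i)) ` ?S) \<in> (\<lambda>i. norm (a i)) ` ?S"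
      using fin nz by (intro Max_in) auto
    then obtain i where i: "a i \<noteq> 0" "norm (a i) = Max ((\<lambda>i. norm (a i)) ` ?S)" by auto
    have "norm (a j) \<le> norm (a i)" for j
    proof (cases "a j = 0")
      case False
      then show ?thesis unfolding i(2) using fin by (intro Max_ge) auto
    qed simp
    then have "c0_norm a \<le> norm (a i)"
      unfolding c0_norm_def by (intro cSUP_least) auto
    moreover define b :: "nat \<Rightarrow> 'k" where "b = unit_vector i"
    moreover have "lp_norm 1 b = 1"
      by (subst lp_norm_finite [of "{i}"]) (auto simp: b_def unit_vector_def)
    moreover have "(\<Sum>j\<in>?S. a j * b j) = a i"
      using i fin by (simp add: b_def unit_vector_def if_distrib cong: if_cong)
    ultimately show ?thesis
      using 1 i by (intro exI [of _ b]) (auto simp: recip_lp_norm_def unit_vector_def)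
  next
    case 2
    \<comment> \<open>Dividing by \<open>a i\<close> replaces the conjugate sign in any scalar
      field, and division by zero gives 0 off the support.\<close>
    define b where "b i = of_real (norm (a i)) / a i" for i
    have nb: "norm (b i) = (if a i = 0 then 0 else 1)" for i
      by (simp add: b_def norm_divide)
    have supp: "{i. b i \<noteq> 0} = ?S" by (auto simp: b_def)
    have "c0_norm b \<le> 1"
      unfolding c0_norm_def by (intro cSUP_least) (auto simp: nb)
    obtain i where "a i \<noteq> 0" using nz by auto
    then have "c0_norm b \<ge> 1"
      using norm_le_c0_norm [of b i] supp fin nb [of i] by simp
    have "(\<Sum>i\<in>?S. a i * b i) = of_real (\<Sum>i\<in>?S. norm (a i))"
      by (simp add: b_def)
    then have "norm (\<Sum>i\<in>?S. a i * b i) = (\<Sum>i\<in>?S. norm (a i))"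
      by (simp only: norm_of_real) (simp add: sum_nonneg)
    moreover have "lp_norm 1 a = (\<Sum>i\<in>?S. norm (a i))"
      using fin by (subst lp_norm_finite [of ?S]) (auto simp: sum_nonneg)
    ultimately show ?thesis
      using 2 supp \<open>c0_norm b \<le> 1\<close> \<open>c0_norm b \<ge> 1\<close>
      by (intro exI [of _ b]) (auto simp: recip_lp_norm_def sum_nonneg)
  next
    case 3
    define p where "p = 1 / \<theta>"
    \<comment> \<open>Then \<open>a i * b i\<close> is the p-th power of \<open>norm (a i)\<close>,
      while \<open>norm (b i)\<close> is the power \<open>p - 1\<close>, and
      \<open>(p - 1) / (1 - \<theta>) = p\<close>.\<close>
    define b where "b i = of_real (norm (a i) powr p) / a i" for i
    define T where "T = (\<Sum>i\<in>?S. norm (a i) powr p)"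
    obtain i where "a i \<noteq> 0" using nz by auto
    then have "0 < norm (a i) powr p" by simp
    also have "\<dots> \<le> T"
      unfolding T_def using fin \<open>a i \<noteq> 0\<close> by (intro member_le_sum) auto
    finally have T: "T > 0" .
    have supp: "{i. b i \<noteq> 0} = ?S" by (auto simp: b_def)
    have pw: "norm (b i) powr (1 / (1 - \<theta>)) = norm (a i) powr p" if "a i \<noteq> 0" for i
    proof -
      have "norm (b i) = norm (a i) powr (p - 1)"
        using that by (simp add: b_def norm_divide powr_diff)
      moreover have "(p - 1) * (1 / (1 - \<theta>)) = p"
        using 3 by (simp add: p_def field_simps)
      ultimately show ?thesis by (simp only: powr_powr)
    qed
    have b: "recip_lp_norm (1 - \<theta>) b = T powr (1 - \<theta>)"
    proof -
      have "lp_norm (1 / (1 - \<theta>)) b = (\<Sum>i\<in>?S. norm (b i) powr (1 / (1 - \<theta>))) powr (1 / (1 / (1 - \<theta>)))"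
        using fin supp by (intro lp_norm_finite) auto
      also have "(\<Sum>i\<in>?S. norm (b i) powr (1 / (1 - \<theta>))) = T"
        unfolding T_def using pw by (intro sum.cong) auto
      finally show ?thesis using 3 by (simp add: recip_lp_norm_def)
    qed
    have a: "recip_lp_norm \<theta> a = T powr \<theta>"
    proof -
      have "lp_norm p a = T powr (1 / p)"
        unfolding T_def using fin by (intro lp_norm_finite) auto
      then show ?thesis using 3 by (simp add: recip_lp_norm_def p_def)
    qed
    have "(\<Sum>i\<in>?S. a i * b i) = of_real T"
      by (simp add: b_def T_def)
    then have "norm (\<Sum>i\<in>?S. a i * b i) = T"
      using T by simp
    moreover have "T powr \<theta> * T powr (1 - \<theta>) = T"
      using T by (simp flip: powr_add)
    ultimately show ?thesis
      using a b supp T by (intro exI [of _ b]) auto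
  qed
qed

section \<open>Products and powers in the span of a biorthogonal sequence\<close>

text \<open>Interpreted twice: for \<open>e\<close> with the functionals \<open>e'\<close>, and for
  \<open>e'\<close> with evaluation at the \<open>e i\<close>. All facts on the product thus serve
  both sides of the duality.\<close>

locale biorthogonal_sequence = normed_vector_space smul
  for smul :: "'k::real_normed_field \<Rightarrow> 'a::real_normed_vector \<Rightarrow> 'a" +
  fixes f :: "nat \<Rightarrow> 'a" and f' :: "nat \<Rightarrow> 'a \<Rightarrow> 'k"
  assumes f'_add: "f' i (x + y) = f' i x + f' i y"
    and f'_smul: "f' i (smul c x) = c * f' i x"
    and f'_f: "f' i (f j) = (if i = j then 1 else 0)"
begin

lemma f'_sum: "f' i (sum g A) = (\<Sum>x\<in>A. f' i (g x))"
  using f'_smul [of i 0 0] by (induction A rule: infinite_finite_induct) (auto simp: f'_add)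

lemma inj_f: "inj f"
  by (rule injI) (metis f'_f zero_neq_one)

lemma independent_range_f: "independent (range f)"
proof
  assume "dependent (range f)"
  then obtain t u v where t: "finite t" "t \<subseteq> range f" "(\<Sum>w\<in>t. smul (u w) w) = 0" "v \<in> t" "u v \<noteq> 0"
    unfolding dependent_explicit by blast
  then obtain i where i: "v = f i" by blast
  have "0 = f' i (\<Sum>w\<in>t. smul (u w) w)"
    using f'_smul [of i 0 0] t by simp
  also have "\<dots> = (\<Sum>w\<in>t. if w = v then u v else 0)"
    unfolding f'_sum using t(2) inj_f by (intro sum.cong) (auto simp: f'_smul f'_f i inj_eq)
  also have "\<dots> = u v" using t by simp
  finally show False using t by simp
qed

lemma seq_coeff_sum:
  assumes "finite A"
  shows "seq_coeff smul f (\<Sum>i\<in>A. smul (a i) (f i)) k = (if k \<in> A then a k else 0)"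
proof -
  have "seq_coeff smul f (\<Sum>i\<in>A. smul (a i) (f i)) k = (\<Sum>i\<in>A. a i * (if f k = f i then 1 else 0))"
    unfolding seq_coeff_def
    by (subst representation_sum)
      (auto simp: independent_range_f representation_basis span_base
        representation_scale [OF independent_range_f span_base [OF rangeI]]
        intro!: span_scale)
  also have "\<dots> = (\<Sum>i\<in>A. if k = i then a i else 0)"
    by (intro sum.cong) (auto simp: inj_eq [OF inj_f])
  finally show ?thesis using assms by simp
qed

lemma seq_length_sum_le: "seq_length smul f (\<Sum>i<m. smul (a i) (f i)) \<le> m"
  unfolding seq_length_def by (rule Least_le) (simp add: seq_coeff_sum)

lemma seq_length_sum:
  assumes "a m \<noteq> 0"
  shows "seq_length smul f (\<Sum>i<Suc m. smul (a i) (f i)) = Suc m"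
  unfolding seq_length_def
proof (rule Least_equality)
  fix n
  assume "\<forall>i\<ge>n. seq_coeff smul f (\<Sum>i<Suc m. smul (a i) (f i)) i = 0"
  then show "Suc m \<le> n"
    using assms by (force simp: seq_coeff_sum not_less_eq_eq simp del: sum.lessThan_Suc)
qed (simp add: seq_coeff_sum del: sum.lessThan_Suc)

lemma seq_coeff_eq_0:
  assumes "seq_length smul f (\<Sum>i<m. smul (a i) (f i)) \<le> i" "i < m"
  shows "a i = 0"
proof -
  have "\<forall>i\<ge>seq_length smul f (\<Sum>i<m. smul (a i) (f i)). seq_coeff smul f (\<Sum>i<m. smul (a i) (f i)) i = 0"
    unfolding seq_length_def by (rule LeastI [of _ m]) (simp add: seq_coeff_sum)
  with assms(1) have "seq_coeff smul f (\<Sum>i<m. smul (a i) (f i)) i = 0" by blast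
  then show ?thesis
    using assms(2) by (simp add: seq_coeff_sum)
qed

text \<open>The length of the right factor sets the block size, so its last coefficient must be
  nonzero; the left factor may be padded with zeros. Position \<open>k\<close> lies in block
  \<open>k div Suc m\<close> at place \<open>k mod Suc m\<close>.\<close>

lemma seq_mult_sum:
  assumes "b m \<noteq> 0"
  shows "seq_mult smul f (\<Sum>i<L. smul (a i) (f i)) (\<Sum>j<Suc m. smul (b j) (f j)) =
    (\<Sum>k<L * Suc m. smul (a (k div Suc m) * b (k mod Suc m)) (f k))"
proof -
  let ?u = "\<Sum>i<L. smul (a i) (f i)" and ?v = "\<Sum>j<Suc m. smul (b j) (f j)"
  let ?g = "\<lambda>i. smul (a i) (\<Sum>j<Suc m. smul (b j) (f (i * Suc m + j)))"
  have len: "seq_length smul f ?v = Suc m"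
    by (rule seq_length_sum [where a = b and m = m, OF assms])
  have "seq_mult smul f ?u ?v = (\<Sum>i<seq_length smul f ?u. ?g i)"
    unfolding seq_mult_def len
    using seq_length_sum_le [of a L]
    by (intro sum.cong arg_cong2 [where f = smul] refl)
      (auto simp: seq_coeff_sum simp del: sum.lessThan_Suc)
  \<comment> \<open>From the true length of the left factor up to \<open>L\<close> the coefficients
    vanish.\<close>
  also have "\<dots> = (\<Sum>i<L. ?g i)"
    using seq_length_sum_le [of a L] seq_coeff_eq_0 [of a L]
    by (intro sum.mono_neutral_left) (auto simp: not_less)
  also have "\<dots> = (\<Sum>k<L * Suc m. smul (a (k div Suc m) * b (k mod Suc m)) (f k))"
    unfolding sum_lessThan_mult
  proof (intro sum.cong refl)
    fix i
    have "smul (a i) (smul (b j) (f (i * Suc m + j))) =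
        smul (a ((i * Suc m + j) div Suc m) * b ((i * Suc m + j) mod Suc m)) (f (i * Suc m + j))"
      if "j < Suc m" for j
      using that by (simp del: mult_Suc_right)
    then show "?g i = (\<Sum>j<Suc m. smul (a ((i * Suc m + j) div Suc m) * b ((i * Suc m + j) mod Suc m))
        (f (i * Suc m + j)))"
      unfolding scale_sum_right by (intro sum.cong) auto
  qed
  finally show ?thesis .
qed

lemma seq_power_sum:
  assumes "a m \<noteq> 0" "n \<ge> 1"
  shows "seq_power smul f (\<Sum>i<Suc m. smul (a i) (f i)) n =
    (\<Sum>k<Suc m ^ n. smul (digit_prod a (Suc m) n k) (f k))"
proof -
  let ?v = "\<Sum>i<Suc m. smul (a i) (f i)"
  \<comment> \<open>The iteration starts at the vector itself, so \<open>l\<close> rounds give the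
    power \<open>Suc l\<close>; each round multiplies on the right and appends a lowest
    digit.\<close>
  have "((\<lambda>w. seq_mult smul f w ?v) ^^ l) ?v =
      (\<Sum>k<Suc m ^ Suc l. smul (digit_prod a (Suc m) (Suc l) k) (f k))" for l
  proof (induction l)
    case 0
    show ?case by (auto simp del: sum.lessThan_Suc intro!: sum.cong)
  next
    case (Suc l)
    then show ?case
      using seq_mult_sum [where b = a and m = m and a = "digit_prod a (Suc m) (Suc l)"
          and L = "Suc m ^ Suc l", OF assms(1)]
      by (simp add: mult_ac del: sum.lessThan_Suc)
  qed
  from this [of "n - 1"] show ?thesis
    using assms by (simp add: seq_power_def del: sum.lessThan_Suc)
qed

text \<open>The coefficients of the \<open>n\<close>-th power are monomials of degree \<open>n\<close> in those of the vector, so they take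
  only polynomially many (in \<open>n\<close>) values; the sum over the positions with a given value is a multiple
  of a sum of basis vectors, and \<open>n\<close>-th roots remove the polynomial factor.\<close>

lemma norm_sum_le_of_power_estimate:
  assumes power: "\<And>n v. n \<ge> 1 \<Longrightarrow> v \<in> span (range f) \<Longrightarrow>
      norm v ^ n \<le> K ^ n * norm (seq_power smul f v n)"
    and sums: "\<And>A. finite A \<Longrightarrow> norm (sum f A) \<le> C * real (card A) powr \<theta>"
    and nonneg: "K \<ge> 0" "C \<ge> 0" "N \<ge> 0" and "a m \<noteq> 0"
    and N: "\<And>n c. norm c * real (card {k. k < Suc m ^ n \<and> digit_prod a (Suc m) n k = c}) powr \<theta> \<le> N ^ n"
  shows "norm (\<Sum>i<Suc m. smul (a i) (f i)) \<le> K * N"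
proof (rule le_of_power_le_poly_mult_power)
  fix n :: nat
  assume n: "n \<ge> 1"
  let ?v = "\<Sum>i<Suc m. smul (a i) (f i)"
  let ?A = "{..<Suc m ^ n}" and ?P = "digit_prod a (Suc m) n"
  have "seq_power smul f ?v n = (\<Sum>c\<in>?P ` ?A. \<Sum>k | k \<in> ?A \<and> ?P k = c. smul (?P k) (f k))"
    unfolding seq_power_sum [where a = a and m = m and n = n, OF \<open>a m \<noteq> 0\<close> n] by (rule sum.image_gen) simp
  also have "\<dots> = (\<Sum>c\<in>?P ` ?A. smul c (sum f {k. k \<in> ?A \<and> ?P k = c}))"
    by (intro sum.cong refl) (auto simp: scale_sum_right intro: sum.cong)
  also have "norm \<dots> \<le> real (card (?P ` ?A)) * (C * N ^ n)"
  proof (rule sum_norm_le [THEN order_trans])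
    show "norm (smul c (sum f {k. k \<in> ?A \<and> ?P k = c})) \<le> C * N ^ n" for c
    proof -
      have "norm c * norm (sum f {k. k \<in> ?A \<and> ?P k = c}) \<le>
          norm c * (C * real (card {k. k \<in> ?A \<and> ?P k = c}) powr \<theta>)"
        by (intro mult_left_mono sums) auto
      also have "\<dots> \<le> C * N ^ n"
        using mult_left_mono [OF N [of c n] \<open>C \<ge> 0\<close>] by (simp add: mult_ac)
      finally show ?thesis by (simp add: norm_scale)
    qed
  qed simp
  also have "\<dots> \<le> real ((n + 1) ^ Suc m) * (C * N ^ n)"
    using nonneg card_range_digit_prod_le [of "Suc m" a n ?A]
    by (intro mult_right_mono) (auto simp only: of_nat_le_iff intro: mult_nonneg_nonneg zero_le_power)
  finally have "norm (seq_power smul f ?v n) \<le> real ((n + 1) ^ Suc m) * (C * N ^ n)" .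
  then have "K ^ n * norm (seq_power smul f ?v n) \<le> K ^ n * (real ((n + 1) ^ Suc m) * (C * N ^ n))"
    using nonneg by (intro mult_left_mono) auto
  moreover have "norm ?v ^ n \<le> K ^ n * norm (seq_power smul f ?v n)"
    by (intro power n span_sum span_scale span_base) auto
  ultimately show "norm ?v ^ n \<le> C * real (n + 1) ^ Suc m * (K * N) ^ n"
    by (simp only: power_mult_distrib of_nat_power mult_ac)
qed (use nonneg in simp)

text \<open>The estimate on level sets holds with \<open>N\<close> the sequence norm: a Chebyshev
  bound on how often the value \<open>c\<close> occurs, combined with multiplicativity of the l_p
  norm. The constant \<open>C\<close> is lost in the n-th roots.\<close>

lemma norm_sum_le_recip_lp_norm:
  assumes power: "\<And>n v. n \<ge> 1 \<Longrightarrow> v \<in> span (range f) \<Longrightarrow>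
      norm v ^ n \<le> K ^ n * norm (seq_power smul f v n)"
    and sums: "\<And>A. finite A \<Longrightarrow> norm (sum f A) \<le> C * real (card A) powr \<theta>"
    and nonneg: "K \<ge> 0" "C \<ge> 0" "\<theta> \<ge> 0" and fin: "finite {i. a i \<noteq> 0}"
  shows "norm (\<Sum>i | a i \<noteq> 0. smul (a i) (f i)) \<le> K * recip_lp_norm \<theta> a"
proof (cases "{i. a i \<noteq> 0} = {}")
  case True
  then show ?thesis
    using mult_nonneg_nonneg [OF nonneg(1) recip_lp_norm_nonneg [OF fin, of \<theta>]]
    by (simp only: sum.empty norm_zero)
next
  case False
  \<comment> \<open>Cutting at the last nonzero coefficient makes \<open>Suc m\<close> the length,
    as the formula for powers requires.\<close>
  define m where "m = Max {i. a i \<noteq> 0}"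
  have m: "a m \<noteq> 0"
    using Max_in [OF fin False] by (simp add: m_def)
  have supp: "i < Suc m" if "a i \<noteq> 0" for i
    using Max_ge [OF fin] that by (simp add: m_def less_Suc_eq_le)
  have "(\<Sum>i | a i \<noteq> 0. smul (a i) (f i)) = (\<Sum>i<Suc m. smul (a i) (f i))"
    using supp by (intro sum.mono_neutral_left) auto
  also have "norm \<dots> \<le> K * recip_lp_norm \<theta> a"
  proof (rule norm_sum_le_of_power_estimate [OF power sums])
    fix n and c :: 'k
    let ?G = "{k. k < Suc m ^ n \<and> digit_prod a (Suc m) n k = c}"
    show "norm c * real (card ?G) powr \<theta> \<le> recip_lp_norm \<theta> a ^ n"
    \<comment> \<open>A value that is not attained contributes 0 even for
      \<open>\<theta> = 0\<close>, since \<open>0 powr 0 = 0\<close>; an attained one is a product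
      of \<open>n\<close> coefficients.\<close>
    proof (cases "?G = {}")
      case True
      show ?thesis
        unfolding True using recip_lp_norm_nonneg [OF fin, of \<theta>] by simp
    next
      case nonempty: False
      show ?thesis
      proof (cases "\<theta> = 0")
        case True
        have "norm c \<le> c0_norm a ^ n"
          using nonempty norm_digit_prod_le [of "Suc m" a "c0_norm a" n] norm_le_c0_norm [OF fin] by auto
        then show ?thesis
          using True zero_le_power [OF recip_lp_norm_nonneg [OF fin, of 0], of n]
          by (simp add: recip_lp_norm_def)
      next
        case False
        define p where "p = 1 / \<theta>"
        have \<theta>: "\<theta> > 0" using False nonneg by simp
        define T where "T = (\<Sum>j<Suc m. norm (a j) powr p)"
        have "T \<ge> 0" unfolding T_def by (rule sum_nonneg) simp
        \<comment> \<open>Chebyshev: keep only the positions with value \<open>c\<close> in the sum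
          that equals \<open>T ^ n\<close>, then raise to the power
          \<open>\<theta> = 1 / p\<close>.\<close>
        have "real (card ?G) * norm c powr p = (\<Sum>k\<in>?G. norm (digit_prod a (Suc m) n k) powr p)"
          by simp
        also have "\<dots> \<le> (\<Sum>k<Suc m ^ n. norm (digit_prod a (Suc m) n k) powr p)"
          by (intro sum_mono2) auto
        also have "\<dots> = T ^ n"
          by (simp only: T_def sum_norm_digit_prod_powr)
        finally have "(real (card ?G) * norm c powr p) powr \<theta> \<le> (T ^ n) powr \<theta>"
          using \<theta> by (intro powr_mono2) auto
        also have "(real (card ?G) * norm c powr p) powr \<theta> = norm c * real (card ?G) powr \<theta>"
          using \<theta> by (simp add: powr_mult powr_powr p_def)
        also have "(T ^ n) powr \<theta> = (T powr \<theta>) ^ n"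
          using \<open>T \<ge> 0\<close> by (induction n) (auto simp: powr_mult)
        also have "T powr \<theta> = recip_lp_norm \<theta> a"
        proof -
          have "lp_norm p a = T powr (1 / p)"
            unfolding T_def using supp by (intro lp_norm_finite) auto
          then show ?thesis using \<theta> by (simp add: recip_lp_norm_def p_def)
        qed
        finally show ?thesis .
      qed
    qed
  qed (use m nonneg recip_lp_norm_nonneg [OF fin] in auto)
  finally show ?thesis .
qed

end

section \<open>Coefficient functionals and the proof of equivalence\<close>

text \<open>By uniform boundedness it suffices to bound the coefficients of one vector. The terms of
  its convergent expansion are bounded, and the norms of the \<open>e i\<close> are bounded away
  from 0.\<close>

lemma biorthogonal_functionals_bounded:
  fixes e :: "nat \<Rightarrow> 'a::banach" and e' :: "nat \<Rightarrow> 'a \<Rightarrow>\<^sub>L 'k::real_normed_field"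
  assumes "normed_vector_space smul"
    and basis: "schauder_basis smul e"
    and semi: "semi_normalized e"
    and bi: "biorthogonal_functionals smul e e'"
  shows "bdd_above (range (\<lambda>i. norm (e' i)))"
proof (rule uniform_boundedness)
  interpret normed_vector_space smul by fact
  fix x
  obtain a where a: "(\<lambda>i. smul (a i) (e i)) sums x"
    using basis unfolding schauder_basis_def by (meson ex1_implies_ex)
  have coeff: "blinfun_apply (e' j) x = a j" for j
  proof -
    have "(\<lambda>i. blinfun_apply (e' j) (smul (a i) (e i))) sums blinfun_apply (e' j) x"
      by (rule bounded_linear.sums [OF blinfun.bounded_linear_right a])
    moreover have "blinfun_apply (e' j) (smul (a i) (e i)) = (if i = j then a i else 0)" for i
      using bi by (auto simp: biorthogonal_functionals_def dual_space_def)
    ultimately have "(\<lambda>i. if i = j then a i else 0) sums blinfun_apply (e' j) x"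
      by simp
    then show ?thesis
      by (rule sums_unique2 [OF _ sums_single])
  qed
  define d where "d = (INF i. norm (e i))"
  have d: "d > 0" "d \<le> norm (e i)" for i
    using semi by (auto simp: semi_normalized_def d_def intro!: cINF_lower bdd_belowI2 [where m = 0])
  have "(\<lambda>i. smul (a i) (e i)) \<longlonglongrightarrow> 0"
    using a by (intro summable_LIMSEQ_zero sums_summable)
  then have "Bseq (\<lambda>i. smul (a i) (e i))"
    by (rule convergent_imp_Bseq [OF convergentI])
  then obtain B where B: "\<And>i. norm (smul (a i) (e i)) \<le> B"
    by (auto simp: Bseq_def)
  have "norm (blinfun_apply (e' i) x) \<le> B / d" for i
  proof -
    have "norm (a i) * d \<le> norm (a i) * norm (e i)"
      using d by (intro mult_left_mono) auto
    then show ?thesis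
      using B [of i] d by (simp add: coeff norm_scale field_simps)
  qed
  then show "bdd_above (range (\<lambda>i. norm (blinfun_apply (e' i) x)))"
    by (auto simp: bdd_above_def)
qed

lemma sum_seq_scale_unit_vector:
  fixes a :: "nat \<Rightarrow> 'k::real_normed_field"
  assumes "finite {i. a i \<noteq> 0}"
  shows "(\<Sum>i | a i \<noteq> 0. seq_scale (a i) (unit_vector i)) = a"
proof
  have "(\<Sum>i\<in>A. seq_scale (a i) (unit_vector i)) j = (\<Sum>i\<in>A. if i = j then a i else 0)" for A j
    by (induction A rule: infinite_finite_induct) (auto simp: seq_scale_def unit_vector_def)
  then show "(\<Sum>i | a i \<noteq> 0. seq_scale (a i) (unit_vector i)) j = a j" for j
    using assms by simp
qed

theorem proposition6:
  fixes smul :: "'k::real_normed_field \<Rightarrow> 'a::banach \<Rightarrow> 'a"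
    and e :: "nat \<Rightarrow> 'a"
    and e' :: "nat \<Rightarrow> 'a \<Rightarrow>\<^sub>L 'k"
  assumes "normed_vector_space smul"
    and "schauder_basis smul e"
    and "semi_normalized e"
    and "biorthogonal_functionals smul e e'"
    and "bidemocratic e e'"
    and "\<exists>K>0. \<forall>n\<ge>1. \<forall>\<alpha>\<in>module.span smul (range e). \<forall>\<alpha>'\<in>module.span dual_scale (range e').
           norm \<alpha> ^ n \<le> K ^ n * norm (seq_power smul e \<alpha> n) \<and>
           norm \<alpha>' ^ n \<le> K ^ n * norm (seq_power dual_scale e' \<alpha>' n)"
  shows "equivalent_seqs smul norm e seq_scale c0_norm unit_vector \<or>
    (\<exists>p\<ge>1. equivalent_seqs smul norm e seq_scale (lp_norm p) unit_vector)"
proof -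
  interpret E: normed_vector_space smul by fact
  interpret E': normed_vector_space "dual_scale :: 'k \<Rightarrow> ('a \<Rightarrow>\<^sub>L 'k) \<Rightarrow> ('a \<Rightarrow>\<^sub>L 'k)"
    by (rule normed_vector_space_dual_scale)
  have e'_smul: "blinfun_apply (e' i) (smul c x) = c * blinfun_apply (e' i) x"
    and e'_e: "blinfun_apply (e' i) (e j) = (if i = j then 1 else 0)" for i j c x
    using assms(4) by (auto simp: biorthogonal_functionals_def dual_space_def)
  interpret E: biorthogonal_sequence smul e "\<lambda>i. blinfun_apply (e' i)"
    by unfold_locales (auto simp: e'_smul e'_e blinfun.bilinear_simps)
  interpret E': biorthogonal_sequence dual_scale e' "\<lambda>i g. blinfun_apply g (e i)"
    by unfold_locales (auto simp: e'_e blinfun.bilinear_simps)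

  obtain B where B: "norm (e i) \<le> B" for i
    using assms(3) by (auto simp: semi_normalized_def bdd_above_def)
  obtain B' where B': "norm (e' i) \<le> B'" for i
    using biorthogonal_functionals_bounded [OF assms(1-4)] by (auto simp: bdd_above_def)
  \<comment> \<open>The two estimates share their quantifiers; taking the zero vector of the other
    span separates them.\<close>
  obtain K where K: "K > 0"
    and power: "\<And>n v. n \<ge> 1 \<Longrightarrow> v \<in> E.span (range e) \<Longrightarrow>
      norm v ^ n \<le> K ^ n * norm (seq_power smul e v n)"
    and power': "\<And>n v. n \<ge> 1 \<Longrightarrow> v \<in> E'.span (range e') \<Longrightarrow>
      norm v ^ n \<le> K ^ n * norm (seq_power dual_scale e' v n)"
    using assms(6) E.span_zero E'.span_zero by meson

  \<comment> \<open>Fundamental functions and initial sums\<close>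
  define \<Phi> where "\<Phi> = fundamental_function e"
  define \<Phi>' where "\<Phi>' = fundamental_function e'"
  define u where "u m = norm (\<Sum>i<m. e i)" for m
  define u' where "u' m = norm (\<Sum>i<m. e' i)" for m
  have u_le: "u m \<le> \<Phi> m" and u'_le: "u' m \<le> \<Phi>' m" for m
    unfolding u_def u'_def \<Phi>_def \<Phi>'_def
    using norm_sum_le_fundamental_function [OF B, of "{..<m}" m]
      norm_sum_le_fundamental_function [OF B', of "{..<m}" m] by auto
  have pairing: "real m \<le> u' m * u m" for m
  proof -
    have "blinfun_apply (\<Sum>i<m. e' i) (\<Sum>j<m. e j) = (\<Sum>i<m. \<Sum>j<m. if i = j then 1 else 0)"
      by (simp add: blinfun.sum_left blinfun.sum_right e'_e)
    also have "\<dots> = of_nat m" by simp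
    finally show ?thesis
      using norm_blinfun [of "\<Sum>i<m. e' i" "\<Sum>j<m. e j"] by (simp add: u_def u'_def)
  qed
  have u_pos: "u m > 0" and u'_pos: "u' m > 0" if "m \<ge> 1" for m
    using pairing [of m] that by (auto simp: u_def u'_def)
  have \<Phi>_pos: "\<Phi> m > 0" and \<Phi>'_pos: "\<Phi>' m > 0" if "m \<ge> 1" for m
    using u_pos u'_pos u_le u'_le that by (meson less_le_trans)+
  obtain D0 where D0: "D0 > 0" "\<And>n. n \<ge> 1 \<Longrightarrow> \<Phi>' n / D0 \<le> real n / \<Phi> n"
    using assms(5) unfolding bidemocratic_def asymp_equal_def \<Phi>_def \<Phi>'_def by blast
  \<comment> \<open>Being at least 1, a single factor \<open>D\<close> can later be absorbed into
    \<open>D ^ n\<close>.\<close>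
  define D where "D = max 1 D0"
  have D: "D \<ge> 1" by (simp add: D_def)
  have duality: "\<Phi>' n * \<Phi> n \<le> D * real n" if "n \<ge> 1" for n
  proof -
    have "\<Phi>' n * \<Phi> n \<le> D0 * real n"
      using D0(2) [OF that] D0(1) \<Phi>_pos [OF that] by (simp add: field_simps)
    also have "\<dots> \<le> D * real n" by (intro mult_right_mono) (auto simp: D_def)
    finally show ?thesis .
  qed
  \<comment> \<open>Initial sets are extremal up to \<open>D\<close>: bidemocracy bounds
    \<open>u' m * \<Phi> m\<close> by a multiple of \<open>m\<close>, which \<open>pairing\<close>
    bounds by the same multiple of \<open>u' m * u m\<close>.\<close>
  have \<Phi>_le: "\<Phi> m \<le> D * u m" if "m \<ge> 1" for m
  proof -
    have "u' m * \<Phi> m \<le> D * real m"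
      using duality [OF that] mult_right_mono [OF u'_le [of m], of "\<Phi> m"] \<Phi>_pos [OF that] by linarith
    also have "\<dots> \<le> D * (u' m * u m)"
      using pairing D by (intro mult_left_mono) auto
    finally show ?thesis using u'_pos [OF that] by (simp add: mult.left_commute)
  qed
  have \<Phi>'_le: "\<Phi>' m \<le> D * u' m" if "m \<ge> 1" for m
  proof -
    have "\<Phi>' m * u m \<le> D * real m"
      using duality [OF that] mult_left_mono [OF u_le [of m], of "\<Phi>' m"] \<Phi>'_pos [OF that] by linarith
    also have "\<dots> \<le> D * (u' m * u m)"
      using pairing D by (intro mult_left_mono) auto
    finally show ?thesis using u_pos [OF that] by (simp add: mult.assoc [symmetric])
  qed
  have digit_prod_1: "digit_prod (\<lambda>_. 1) m n k = (1 :: 'k)" for m n k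
    by (induction n arbitrary: k) auto
  \<comment> \<open>With all coefficients 1 every digit product is 1, so the power of an initial sum
    is again an initial sum.\<close>
  have u_power: "u m ^ n \<le> K ^ n * u (m ^ n)" and u'_power: "u' m ^ n \<le> K ^ n * u' (m ^ n)"
    if mn: "m \<ge> 1" "n \<ge> 1" for m n
  proof -
    obtain l where m: "m = Suc l" using mn by (cases m) auto
    have "seq_power smul e (\<Sum>i<m. e i) n = (\<Sum>i<m ^ n. e i)"
      using E.seq_power_sum [of "\<lambda>_. 1" l n] mn by (simp add: m digit_prod_1 del: sum.lessThan_Suc)
    then show "u m ^ n \<le> K ^ n * u (m ^ n)"
      using power [OF mn(2) E.span_sum, of "{..<m}" e] E.span_base by (simp add: u_def)
    have "seq_power dual_scale e' (\<Sum>i<m. e' i) n = (\<Sum>i<m ^ n. e' i)"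
      using E'.seq_power_sum [of "\<lambda>_. 1" l n] mn by (simp add: m digit_prod_1 del: sum.lessThan_Suc)
    then show "u' m ^ n \<le> K ^ n * u' (m ^ n)"
      using power' [OF mn(2) E'.span_sum, of "{..<m}" e'] E'.span_base by (simp add: u'_def)
  qed
  have \<Phi>_power: "\<Phi> m ^ n \<le> (D * K) ^ n * \<Phi> (m ^ n)"
    and \<Phi>'_power: "\<Phi>' m ^ n \<le> (D * K) ^ n * \<Phi>' (m ^ n)"
    if mn: "m \<ge> 1" "n \<ge> 1" for m n
  proof -
    have "\<Phi> m ^ n \<le> D ^ n * u m ^ n"
      using \<Phi>_le [OF mn(1)] \<Phi>_pos [OF mn(1)]
      by (metis less_imp_le power_mono power_mult_distrib)
    also have "\<dots> \<le> D ^ n * (K ^ n * \<Phi> (m ^ n))"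
      using u_power [OF mn] u_le [of "m ^ n"] D K
      by (intro mult_left_mono) (auto intro: order_trans mult_left_mono)
    finally show "\<Phi> m ^ n \<le> (D * K) ^ n * \<Phi> (m ^ n)"
      by (simp add: power_mult_distrib mult.assoc)
    have "\<Phi>' m ^ n \<le> D ^ n * u' m ^ n"
      using \<Phi>'_le [OF mn(1)] \<Phi>'_pos [OF mn(1)]
      by (metis less_imp_le power_mono power_mult_distrib)
    also have "\<dots> \<le> D ^ n * (K ^ n * \<Phi>' (m ^ n))"
      using u'_power [OF mn] u'_le [of "m ^ n"] D K
      by (intro mult_left_mono) (auto intro: order_trans mult_left_mono)
    finally show "\<Phi>' m ^ n \<le> (D * K) ^ n * \<Phi>' (m ^ n)"
      by (simp add: power_mult_distrib mult.assoc)
  qed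

  \<comment> \<open>The growth exponent and its range\<close>
  define L where "L = max 1 (D * D * K)"
  have L: "L \<ge> 1" "D * K \<le> L" "D * D * K \<le> L"
  proof -
    show "L \<ge> 1" "D * D * K \<le> L" by (auto simp: L_def)
    have "1 * (D * K) \<le> D * (D * K)" using D K by (intro mult_right_mono) auto
    then show "D * K \<le> L" by (simp add: L_def)
  qed
  have "\<exists>\<theta> C. C > 0 \<and> (\<forall>m\<ge>1. real m powr \<theta> \<le> C * \<Phi> m \<and> \<Phi> m \<le> C * real m powr \<theta>)"
  proof (rule almost_multiplicative_imp_powr_growth [OF \<Phi>_pos _ L(1)])
    show "\<Phi> m \<le> \<Phi> n" if "m \<le> n" for m n
      unfolding \<Phi>_def by (rule fundamental_function_mono [OF B that])
    fix m n :: nat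
    assume mn: "m \<ge> 1" "n \<ge> 1"
    then have mn1: "m ^ n \<ge> 1" by simp
    have "(D * K) ^ n * \<Phi> (m ^ n) \<le> L ^ n * \<Phi> (m ^ n)"
      using L D K \<Phi>_pos [OF mn1] by (intro mult_right_mono power_mono) auto
    with \<Phi>_power [OF mn] show "\<Phi> m ^ n \<le> L ^ n * \<Phi> (m ^ n)" by linarith
    \<comment> \<open>The upper bound comes from the dual side: a lower bound for
      \<open>\<Phi>' (m ^ n)\<close> bounds \<open>\<Phi> (m ^ n)\<close> from above through
      \<open>duality\<close>.\<close>
    have "real (m ^ n) \<le> (\<Phi>' m * \<Phi> m) ^ n"
    proof -
      have "real m \<le> \<Phi>' m * \<Phi> m"
        using pairing [of m] mult_mono [OF u'_le [of m] u_le [of m]] \<Phi>'_pos [OF mn(1)] u_pos [OF mn(1)]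
        by linarith
      then show ?thesis by (simp add: power_mono)
    qed
    also have "\<dots> \<le> ((D * K) ^ n * \<Phi>' (m ^ n)) * \<Phi> m ^ n"
      unfolding power_mult_distrib [of "\<Phi>' m"]
      using \<Phi>'_power [OF mn] \<Phi>_pos [OF mn(1)] by (intro mult_right_mono) auto
    finally have "real (m ^ n) * \<Phi> (m ^ n) \<le> ((D * K) ^ n * \<Phi>' (m ^ n)) * \<Phi> m ^ n * \<Phi> (m ^ n)"
      using \<Phi>_pos [OF mn1] by (intro mult_right_mono) auto
    also have "\<dots> = ((D * K) ^ n * \<Phi> m ^ n) * (\<Phi>' (m ^ n) * \<Phi> (m ^ n))"
      by (simp add: mult_ac)
    also have "\<dots> \<le> ((D * K) ^ n * \<Phi> m ^ n) * (D * real (m ^ n))"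
      using duality [OF mn1] D K \<Phi>_pos [OF mn(1)] by (intro mult_left_mono) auto
    finally have "real (m ^ n) * \<Phi> (m ^ n) \<le> real (m ^ n) * (D * (D * K) ^ n * \<Phi> m ^ n)"
      by (simp only: mult_ac)
    then have "\<Phi> (m ^ n) \<le> D * (D * K) ^ n * \<Phi> m ^ n"
      using mn(1) by (subst (asm) mult_le_cancel_left_pos) auto
    also have "\<dots> \<le> D ^ n * (D * K) ^ n * \<Phi> m ^ n"
      using D K \<Phi>_pos [OF mn(1)] self_le_power [of D n] mn(2) by (intro mult_right_mono) auto
    also have "\<dots> = (D * D * K) ^ n * \<Phi> m ^ n"
      by (simp add: power_mult_distrib)
    also have "\<dots> \<le> L ^ n * \<Phi> m ^ n"
      using L D K \<Phi>_pos [OF mn(1)] by (intro mult_right_mono power_mono) auto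
    finally show "\<Phi> (m ^ n) \<le> L ^ n * \<Phi> m ^ n" .
  qed
  then obtain \<theta> C where C: "C > 0" and growth_lower: "\<And>m. m \<ge> 1 \<Longrightarrow> real m powr \<theta> \<le> C * \<Phi> m"
    and growth_upper: "\<And>m. m \<ge> 1 \<Longrightarrow> \<Phi> m \<le> C * real m powr \<theta>"
    by blast
  \<comment> \<open>A negative exponent would contradict that \<open>\<Phi>\<close> stays above
    \<open>\<Phi> 1 > 0\<close>.\<close>
  have \<theta>0: "\<theta> \<ge> 0"
  proof -
    have "- \<theta> \<le> 0"
    proof (rule powr_bounded_imp_nonpos)
      fix m :: nat
      assume m: "m \<ge> 1"
      have "\<Phi> 1 \<le> \<Phi> m"
        unfolding \<Phi>_def by (rule fundamental_function_mono [OF B m])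
      also have "\<dots> \<le> C * real m powr \<theta>" by (rule growth_upper [OF m])
      finally show "real m powr - \<theta> \<le> C / \<Phi> 1"
        using m \<Phi>_pos [of 1] by (simp add: powr_minus field_simps)
    qed
    then show ?thesis by simp
  qed
  \<comment> \<open>By the triangle inequality \<open>\<Phi>\<close> grows at most linearly.\<close>
  have \<theta>1: "\<theta> \<le> 1"
  proof -
    have "\<theta> - 1 \<le> 0"
    proof (rule powr_bounded_imp_nonpos)
      fix m :: nat
      assume m: "m \<ge> 1"
      have "real m powr \<theta> \<le> C * (real m * B)"
      proof (rule order_trans [OF growth_lower [OF m]])
        show "C * \<Phi> m \<le> C * (real m * B)"
          unfolding \<Phi>_def using fundamental_function_le [OF B] C by (intro mult_left_mono) auto
      qed
      then show "real m powr (\<theta> - 1) \<le> C * B"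
        using m by (simp add: powr_diff field_simps)
    qed
    then show ?thesis by simp
  qed

  \<comment> \<open>Upper estimates on both sides, and the lower one by duality\<close>
  have sums: "norm (sum e A) \<le> C * real (card A) powr \<theta>" if "finite A" for A
  proof (cases "A = {}")
    case False
    then show ?thesis
      using norm_sum_le_fundamental_function [of e B, OF B that order_refl] growth_upper [of "card A"] that
      by (simp add: \<Phi>_def Suc_le_eq card_gt_0_iff)
  qed simp
  \<comment> \<open>Dividing \<open>duality\<close> by the lower growth bound for
    \<open>\<Phi>\<close> gives the conjugate exponent \<open>1 - \<theta>\<close>.\<close>
  have sums': "norm (sum e' A) \<le> (D * C) * real (card A) powr (1 - \<theta>)" if "finite A" for A
  proof (cases "A = {}")
    case False
    then have n: "card A \<ge> 1" using that by (simp add: Suc_le_eq card_gt_0_iff)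
    have "\<Phi>' (card A) * real (card A) powr \<theta> \<le> \<Phi>' (card A) * (C * \<Phi> (card A))"
      using growth_lower [OF n] \<Phi>'_pos [OF n] by (intro mult_left_mono) auto
    also have "\<dots> = C * (\<Phi>' (card A) * \<Phi> (card A))"
      by (rule mult.left_commute)
    also have "\<dots> \<le> C * (D * real (card A))"
      using duality [OF n] C by (intro mult_left_mono) auto
    finally have "\<Phi>' (card A) \<le> (D * C) * real (card A) powr (1 - \<theta>)"
      using n by (simp add: powr_diff field_simps)
    moreover have "norm (sum e' A) \<le> \<Phi>' (card A)"
      using norm_sum_le_fundamental_function [of e' B', OF B' that order_refl] by (simp add: \<Phi>'_def)
    ultimately show ?thesis by linarith
  qed simp
  have upper: "norm (\<Sum>i | a i \<noteq> 0. smul (a i) (e i)) \<le> K * recip_lp_norm \<theta> a"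
    if "finite {i. a i \<noteq> 0}" for a
    by (rule E.norm_sum_le_recip_lp_norm [OF power sums]) (use K C \<theta>0 that in auto)
  have upper': "norm (\<Sum>i | b i \<noteq> 0. dual_scale (b i) (e' i)) \<le> K * recip_lp_norm (1 - \<theta>) b"
    if "finite {i. b i \<noteq> 0}" for b
    by (rule E'.norm_sum_le_recip_lp_norm [OF power' sums']) (use K C D \<theta>1 that in auto)
  \<comment> \<open>Pair the vector with the functional whose coefficients norm \<open>a\<close>:
    its norm is at most \<open>K\<close> times the conjugate norm of \<open>b\<close>, which then
    cancels.\<close>
  have lower: "recip_lp_norm \<theta> a \<le> K * norm (\<Sum>i | a i \<noteq> 0. smul (a i) (e i))"
    if fin: "finite {i. a i \<noteq> 0}" for a
  proof (cases "{i. a i \<noteq> 0} = {}")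
    case True
    then show ?thesis by (auto simp: recip_lp_norm_def c0_norm_def lp_norm_def)
  next
    case False
    let ?S = "{i. a i \<noteq> 0}"
    obtain b where b: "{i. b i \<noteq> 0} \<subseteq> ?S" "0 < recip_lp_norm (1 - \<theta>) b"
      "recip_lp_norm \<theta> a * recip_lp_norm (1 - \<theta>) b \<le> norm (\<Sum>i\<in>?S. a i * b i)"
      using holder_extremal [OF fin False \<theta>0 \<theta>1] by blast
    let ?x = "\<Sum>i\<in>?S. smul (a i) (e i)" and ?g = "\<Sum>i | b i \<noteq> 0. dual_scale (b i) (e' i)"
    have "?g = (\<Sum>i\<in>?S. dual_scale (b i) (e' i))"
      using b(1) fin by (intro sum.mono_neutral_left) auto
    then have "blinfun_apply ?g ?x = (\<Sum>i\<in>?S. b i * (\<Sum>j\<in>?S. if i = j then a j else 0))"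
      by (simp add: blinfun.sum_left E.f'_sum e'_smul e'_e if_distrib cong: if_cong)
    also have "\<dots> = (\<Sum>i\<in>?S. a i * b i)"
      using fin by (intro sum.cong) auto
    finally have "norm (\<Sum>i\<in>?S. a i * b i) \<le> norm ?g * norm ?x"
      using norm_blinfun [of ?g ?x] by simp
    also have "\<dots> \<le> K * recip_lp_norm (1 - \<theta>) b * norm ?x"
      using b(1) fin by (intro mult_right_mono upper') (auto intro: finite_subset)
    finally have "recip_lp_norm \<theta> a * recip_lp_norm (1 - \<theta>) b \<le>
        (K * norm ?x) * recip_lp_norm (1 - \<theta>) b"
      using b(3) by (simp add: mult_ac)
    then show ?thesis using b(2) by (rule mult_right_le_imp_le)
  qed
  \<comment> \<open>Both estimates hold with the constant \<open>K\<close> of the hypothesis; it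
    remains to read \<open>\<theta> = 0\<close> as c_0 and otherwise
    \<open>p = 1 / \<theta>\<close>.\<close>
  have equiv: "equivalent_seqs smul norm e seq_scale (recip_lp_norm \<theta>) unit_vector"
    unfolding equivalent_seqs_def
    using K upper lower by (intro exI [of _ K]) (simp add: sum_seq_scale_unit_vector field_simps)
  show ?thesis
  proof (cases "\<theta> = 0")
    case True
    then have "recip_lp_norm \<theta> = (c0_norm :: (nat \<Rightarrow> 'k) \<Rightarrow> real)"
      by (auto simp: recip_lp_norm_def)
    with equiv show ?thesis by simp
  next
    case False
    then have "recip_lp_norm \<theta> = (lp_norm (1 / \<theta>) :: (nat \<Rightarrow> 'k) \<Rightarrow> real)" "1 / \<theta> \<ge> 1"
      using \<theta>0 \<theta>1 by (auto simp: recip_lp_norm_def)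
    with equiv show ?thesis by metis
  qed
qed

end
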